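(* Let $\mathfrak g$ be a $5$-dimensional non-unimodular real Lie algebra, and let $\beta\in\mathfrak g^*$ be the form corresponding to the linear map $\mathfrak g\to\mathbb R$, $X\mapsto\operatorname{tr}\operatorname{ad}X$. Suppose that either (i) $\dim L_\beta(Z^3)<2$; or (ii) $\dim L_\beta(Z^3)=2$ and for every $\alpha\in\mathfrak g^*$ such that $L_\alpha(L_\beta(Z^3))=0$, one has $L_\alpha(L_\beta(Z^2))\subset L_\beta(Z^3)$. Then $\mathfrak g$ has no hypo structure.
   Context: A Lie algebra is unimodular if $\operatorname{tr}\operatorname{ad}X=0$ for all $X$. For a Lie algebra $\mathfrak g$, $d$ denotes the Chevalley--Eilenberg differential on $\Lambda^*\mathfrak g^*$, and $Z^k\subset\Lambda^k\mathfrak g^*$ is the space of closed $k$-forms. For $\gamma\in\mathfrak g^*$, $L_\gamma\colon\Lambda^j\mathfrak g^*\to\Lambda^{j+1}\mathfrak g^*$ is the map $L_\gamma(\eta)=\gamma\wedge\eta$. A hypo structure on a $5$-dimensional Lie algebra $\mathfrak g$ is a quadruplet $(\alpha,\omega_1,\omega_2,\omega_3)$, with $\alpha\in\mathfrak g^*$ and $\omega_i\in\Lambda^2\mathfrak g^*$, for which there is a basis $f^1,\dots,f^5$ of $\mathfrak g^*$ such that $$\alpha=f^5,\quad \omega_1=f^{12}+f^{34},\quad \omega_2=f^{13}+f^{42},\quad \omega_3=f^{14}+f^{23}\qquad (f^{ij}=f^i\wedge f^j),$$ and such that $d\omega_1=0$, $d(\omega_2\wedge\alpha)=0$ and $d(\omega_3\wedge\alpha)=0$.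 *)

theory Defs
  imports "HOL-Analysis.Analysis" "HOL-Library.Function_Algebras"
begin

(* Pointwise scalar multiplication on functions, so that dim, span and independent
   from the library apply to spaces of forms. *)

instantiation "fun" :: (type, real_vector) real_vector
begin

definition scaleR_fun_def: "scaleR c f = (\<lambda>x. c *\<^sub>R f x)"

instance
  by standard (simp_all add: scaleR_fun_def fun_eq_iff scaleR_add_right scaleR_add_left)

end

definition lie_algebra :: "('a::real_vector \<Rightarrow> 'a \<Rightarrow> 'a) \<Rightarrow> bool" where
  "lie_algebra br \<longleftrightarrow>
     (\<forall>x. linear (br x)) \<and> (\<forall>y. linear (\<lambda>x. br x y)) \<and>
     (\<forall>x. br x x = 0) \<and>
     (\<forall>x y z. br x (br y z) + br y (br z x) + br z (br x y) = 0)"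

(* Only meaningful when the space is finite-dimensional; for linear f the value does
   not depend on the basis that is chosen. *)

definition endo_trace :: "('a::real_vector \<Rightarrow> 'a) \<Rightarrow> real" where
  "endo_trace f =
     (let B = (SOME B. independent B \<and> span B = (UNIV :: 'a set))
      in \<Sum>b\<in>B. representation B (f b) b)"

definition unimodular :: "('a::real_vector \<Rightarrow> 'a \<Rightarrow> 'a) \<Rightarrow> bool" where
  "unimodular br \<longleftrightarrow> (\<forall>X. endo_trace (br X) = 0)"


(* A k-form on 'a is encoded as a function on argument lists which vanishes on every
   list whose length is not k and is multilinear and alternating on lists of length k.
   In particular the dual space is alt_forms 1. *)

type_synonym 'a form = "'a list \<Rightarrow> real"

definition alt_forms :: "nat \<Rightarrow> ('a::real_vector) form set" where
  "alt_forms k = {\<omega>.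
     (\<forall>xs. length xs \<noteq> k \<longrightarrow> \<omega> xs = 0) \<and>
     (\<forall>xs i. length xs = k \<longrightarrow> i < k \<longrightarrow> linear (\<lambda>x. \<omega> (xs[i := x]))) \<and>
     (\<forall>xs i j. length xs = k \<longrightarrow> i < j \<longrightarrow> j < k \<longrightarrow> xs ! i = xs ! j \<longrightarrow> \<omega> xs = 0)}"

definition covector :: "('a \<Rightarrow> real) \<Rightarrow> 'a form" where
  "covector f xs = (case xs of [x] \<Rightarrow> f x | _ \<Rightarrow> 0)"

(* Shuffle formula: the positions in I, in increasing order, are fed to \<omega> and the
   remaining ones to \<eta>; the sign is that of the corresponding shuffle permutation.
   Since a p-form vanishes on lists of length other than p, only the sets I with p
   elements contribute. The normalisation is the one for which
   (f \<and> g)(x, y) = f x * g y - f y * g x for covectors f and g. *)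

definition wedge :: "'a form \<Rightarrow> 'a form \<Rightarrow> 'a form"  (infixr "\<and>\<^sub>f" 75) where
  "(\<omega> \<and>\<^sub>f \<eta>) xs =
     (\<Sum>I \<in> Pow {..<length xs}.
        (-1) ^ card {(i, j). i \<in> I \<and> j \<in> {..<length xs} - I \<and> j < i}
        * \<omega> (nths xs I) * \<eta> (nths xs ({..<length xs} - I)))"

abbreviation L_op :: "'a form \<Rightarrow> 'a form \<Rightarrow> 'a form" where
  "L_op \<gamma> \<equiv> (\<lambda>\<eta>. \<gamma> \<and>\<^sub>f \<eta>)"

(* Chevalley--Eilenberg differential with trivial coefficients: for a k-form \<omega>,
   (d\<omega>)(x_0,...,x_k) is the sum over i < j of
   (-1)^(i+j) \<omega>([x_i,x_j], x_0, ..., x_k) with x_i and x_j omitted. *)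

definition ce_d :: "('a \<Rightarrow> 'a \<Rightarrow> 'a) \<Rightarrow> 'a form \<Rightarrow> 'a form" where
  "ce_d br \<omega> xs =
     (\<Sum>(i, j) \<in> {(i, j). i < j \<and> j < length xs}.
        (-1) ^ (i + j) * \<omega> (br (xs ! i) (xs ! j) # nths xs (- {i, j})))"

definition closed_forms :: "('a::real_vector \<Rightarrow> 'a \<Rightarrow> 'a) \<Rightarrow> nat \<Rightarrow> 'a form set" where
  "closed_forms br k = {\<omega> \<in> alt_forms k. ce_d br \<omega> = 0}"

definition hypo_structure ::
  "('a::real_vector \<Rightarrow> 'a \<Rightarrow> 'a) \<Rightarrow> 'a form \<Rightarrow> 'a form \<Rightarrow> 'a form \<Rightarrow> 'a form \<Rightarrow> bool" where
  "hypo_structure br \<alpha> \<omega>\<^sub>1 \<omega>\<^sub>2 \<omega>\<^sub>3 \<longleftrightarrow>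
     \<alpha> \<in> alt_forms 1 \<and> \<omega>\<^sub>1 \<in> alt_forms 2 \<and> \<omega>\<^sub>2 \<in> alt_forms 2 \<and> \<omega>\<^sub>3 \<in> alt_forms 2 \<and>
     (\<exists>f :: nat \<Rightarrow> 'a form.
        inj_on f {1..5} \<and> independent (f ` {1..5}) \<and> span (f ` {1..5}) = alt_forms 1 \<and>
        \<alpha> = f 5 \<and>
        \<omega>\<^sub>1 = f 1 \<and>\<^sub>f f 2 + f 3 \<and>\<^sub>f f 4 \<and>
        \<omega>\<^sub>2 = f 1 \<and>\<^sub>f f 3 + f 4 \<and>\<^sub>f f 2 \<and>
        \<omega>\<^sub>3 = f 1 \<and>\<^sub>f f 4 + f 2 \<and>\<^sub>f f 3) \<and>
     ce_d br \<omega>\<^sub>1 = 0 \<and> ce_d br (\<omega>\<^sub>2 \<and>\<^sub>f \<alpha>) = 0 \<and> ce_d br (\<omega>\<^sub>3 \<and>\<^sub>f \<alpha>) = 0"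

end

theory Submission
  imports Defs
begin

text \<open>
  Let \<open>f\<close> be a coframe adapted to a hypo structure, \<open>e\<close> the dual basis and \<open>\<alpha> = f\<^sup>5\<close>. The proof shows
  that the three 4-forms \<open>\<beta> \<and> \<omega>\<^sub>i \<and> \<alpha>\<close> are linearly independent; both conditions of the theorem
  contradict this.

  First, \<open>\<beta>(e\<^sub>5) = tr ad e\<^sub>5 = 0\<close>. Evaluating \<open>d\<omega>\<^sub>1 = 0\<close> on \<open>(e\<^sub>5, e\<^sub>1, e\<^sub>2)\<close> and on \<open>(e\<^sub>5, e\<^sub>3, e\<^sub>4)\<close>
  shows that the diagonal entries of \<open>ad e\<^sub>5\<close> cancel in the pairs \<open>1, 2\<close> and \<open>3, 4\<close>, while
  \<open>[e\<^sub>5, e\<^sub>5] = 0\<close> disposes of the last one (\<open>trace_ad_eq_0\<close>). So \<open>\<beta>\<close> is a nonzero covector with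
  coefficients \<open>b\<^sub>1, ..., b\<^sub>4\<close> only.

  Secondly, in terms of \<open>f\<^sup>1\<^sup>2\<^sup>3\<^sup>5, f\<^sup>1\<^sup>2\<^sup>4\<^sup>5, f\<^sup>1\<^sup>3\<^sup>4\<^sup>5, f\<^sup>2\<^sup>3\<^sup>4\<^sup>5\<close> the three products
  \<open>\<beta> \<and> \<omega>\<^sub>i \<and> \<alpha>\<close> have the coefficients \<open>(b\<^sub>3, b\<^sub>4, b\<^sub>1, b\<^sub>2)\<close>, \<open>(-b\<^sub>2, -b\<^sub>1, b\<^sub>4, b\<^sub>3)\<close> and
  \<open>(b\<^sub>1, -b\<^sub>2, -b\<^sub>3, b\<^sub>4)\<close>. These are pairwise orthogonal and have the same nonzero length, hence are
  independent (\<open>wedge_combination_trivial\<close>). Up to sign and the Hodge star of \<open>\<real>\<^sup>4\<close> they are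
  the images of \<open>b\<close> under three anticommuting complex structures.

  Now \<open>\<omega>\<^sub>2 \<and> \<alpha>\<close> and \<open>\<omega>\<^sub>3 \<and> \<alpha>\<close> are closed, so \<open>L\<^sub>\<beta>(Z\<^sup>3)\<close> has dimension at least 2, which excludes (i).
  If the dimension is 2, then \<open>L\<^sub>\<beta>(Z\<^sup>3)\<close> is spanned by \<open>\<beta> \<and> \<omega>\<^sub>2 \<and> \<alpha>\<close> and \<open>\<beta> \<and> \<omega>\<^sub>3 \<and> \<alpha>\<close>, which \<open>L\<^sub>\<alpha>\<close>
  annihilates because \<open>\<alpha> \<and> \<alpha> = 0\<close>. As \<open>\<omega>\<^sub>1\<close> is closed, (ii) puts
  \<open>\<alpha> \<and> \<beta> \<and> \<omega>\<^sub>1 = - \<beta> \<and> \<omega>\<^sub>1 \<and> \<alpha>\<close> into the span of the other two products, against independence.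

  The rest is linear algebra: the coframe has a dual basis that computes the trace, and spaces of forms
  are finitely generated.
\<close>

section \<open>Linear algebra\<close>

lemma span_subset_of_card_le:
  fixes S T :: "'v::real_vector set"
  assumes ind: "independent S" and sub: "S \<subseteq> span T" and fin: "finite T" and card: "card T \<le> card S"
  shows "span T \<subseteq> span S"
proof
  fix w assume w: "w \<in> span T"
  show "w \<in> span S"
  proof (rule ccontr)
    assume nw: "w \<notin> span S"
    then have "w \<notin> S" by (meson span_base)
    have "independent (insert w S)" using ind nw by (simp add: independent_insert \<open>w \<notin> S\<close>)
    moreover have "insert w S \<subseteq> span T" using w sub by simp
    ultimately have "finite (insert w S) \<and> card (insert w S) \<le> card T"
      by (rule independent_span_bound[OF fin])
    then show False using card card_insert_disjoint[OF _ \<open>w \<notin> S\<close>] by simp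
  qed
qed

text \<open>
  The subset \<open>V\<close> is required to lie in a finitely generated space because the dimension of an
  infinite-dimensional space is 0 by convention, so that the lower bound could fail.
\<close>

lemma independent_pair_dim:
  fixes V T :: "'v::real_vector set"
  assumes fin: "finite T" and VT: "V \<subseteq> span T"
    and u: "u \<in> V" and v: "v \<in> V" and ne: "u \<noteq> v" and ind: "independent {u, v}"
  shows "2 \<le> dim V" and "dim V = 2 \<Longrightarrow> V \<subseteq> span {u, v}"
proof -
  obtain b where b: "b \<subseteq> V" "independent b" "V \<subseteq> span b" "card b = dim V"
    by (rule basis_exists)
  have finb: "finite b" using independent_span_bound[OF fin b(2)] b(1) VT by blast
  have sub: "{u, v} \<subseteq> span b" using u v b(3) by blast
  have c2: "card {u, v} = 2" using ne by simp
  show "2 \<le> dim V" using independent_span_bound[OF finb ind sub] c2 b(4) by simp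
  assume "dim V = 2"
  then have "span b \<subseteq> span {u, v}" using span_subset_of_card_le[OF ind sub finb] c2 b(4) by simp
  then show "V \<subseteq> span {u, v}" using b(3) by blast
qed

lemma independent_pairI:
  fixes u v :: "'v::real_vector"
  assumes "\<And>q r. q *\<^sub>R u + r *\<^sub>R v = 0 \<Longrightarrow> q = 0 \<and> r = 0"
  shows "u \<noteq> v" and "independent {u, v}"
proof -
  have v: "v \<noteq> 0" using assms[of 0 1] by auto
  have nu: "u \<notin> span {v}"
  proof
    assume "u \<in> span {v}"
    then obtain k where "u = k *\<^sub>R v" by (auto simp: span_singleton)
    then show False using assms[of 1 "- k"] by simp
  qed
  then show "u \<noteq> v" using span_base[of v "{v}"] by blast
  then show "independent {u, v}" using nu v by (simp add: independent_insert)
qed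

text \<open>
  The trace is defined through an unspecified basis \<open>B\<close>. Expanding every \<open>b \<in> B\<close> as
  \<open>\<Sum>\<^sub>i \<phi>\<^sub>i(b) e\<^sub>i\<close> and exchanging the two sums moves the trace from \<open>B\<close> to the system \<open>(e\<^sub>i, \<phi>\<^sub>i)\<close>.
\<close>

lemma endo_trace_dual_basis:
  fixes A :: "'a::real_vector \<Rightarrow> 'a"
  assumes fin: "finite I" and A: "linear A" and \<phi>: "\<And>i. i \<in> I \<Longrightarrow> linear (\<phi> i)"
    and res: "\<And>x. (\<Sum>i\<in>I. \<phi> i x *\<^sub>R e i) = x"
  shows "endo_trace A = (\<Sum>i\<in>I. \<phi> i (A (e i)))"
proof -
  define B where "B = (SOME B. independent B \<and> span B = (UNIV :: 'a set))"
  have "\<exists>B. independent B \<and> span B = (UNIV :: 'a set)"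
    by (metis basis_exists span_UNIV subset_antisym subset_UNIV)
  then have B: "independent B" "span B = UNIV"
    unfolding B_def by (metis (mono_tags, lifting) someI_ex)+
  have "x \<in> span (e ` I)" for x
    by (subst res[symmetric], rule span_sum, rule span_scale, rule span_base) simp
  then have finB: "finite B"
    using independent_span_bound[OF finite_imageI[OF fin] B(1)] by blast
  have exp: "(\<Sum>b\<in>B. representation B x b *\<^sub>R b) = x" for x
    using sum_representation_eq[OF B(1) _ finB, of x] B(2) by simp
  have lin: "linear (\<lambda>x. representation B x b)" for b
    using B by (intro linearI) (simp_all add: representation_add representation_scale)
  have Ab: "representation B (A b) b = (\<Sum>i\<in>I. \<phi> i b * representation B (A (e i)) b)" for b
  proof -
    have "representation B (A b) b = representation B (A (\<Sum>i\<in>I. \<phi> i b *\<^sub>R e i)) b"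
      by (simp add: res)
    then show ?thesis
      by (simp add: linear_sum[OF A] linear_sum[OF lin] linear_cmul[OF A] linear_cmul[OF lin])
  qed
  have "endo_trace A = (\<Sum>b\<in>B. representation B (A b) b)"
    by (simp add: endo_trace_def B_def Let_def)
  also have "\<dots> = (\<Sum>i\<in>I. \<Sum>b\<in>B. representation B (A (e i)) b * \<phi> i b)"
    unfolding Ab by (subst sum.swap) (simp add: mult.commute)
  also have "\<dots> = (\<Sum>i\<in>I. \<phi> i (\<Sum>b\<in>B. representation B (A (e i)) b *\<^sub>R b))"
    by (intro sum.cong refl) (simp add: linear_sum[OF \<phi>] linear_cmul[OF \<phi>])
  finally show ?thesis by (simp add: exp)
qed

section \<open>Forms and dual bases\<close>

lemma alt_forms_1_linear: "\<gamma> \<in> alt_forms 1 \<Longrightarrow> linear (\<lambda>x. \<gamma> [x])"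
  unfolding alt_forms_def by (auto dest!: spec[where x="[undefined]"])

lemma alt_forms_vanish: "\<omega> \<in> alt_forms k \<Longrightarrow> length xs \<noteq> k \<Longrightarrow> \<omega> xs = 0"
  unfolding alt_forms_def by blast

lemma covector_in_alt_forms: "linear \<phi> \<Longrightarrow> covector \<phi> \<in> alt_forms 1"
  unfolding alt_forms_def covector_def by (auto split: list.splits simp: length_Suc_conv)

text \<open>
  The components of the coframe define a linear map \<open>\<Phi>\<close> into the span of the unit vectors \<open>\<delta>\<^sub>i\<close>. It is
  injective, since a vector on which the coframe vanishes is annihilated by every
  functional, in particular by all coordinates with respect to a basis. By the count of dimensions it
  is onto, and the \<open>e\<^sub>i\<close> are the preimages of the \<open>\<delta>\<^sub>i\<close>.
\<close>

lemma coframe_dual_basis: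
  fixes f :: "nat \<Rightarrow> 'a::real_vector form"
  assumes fin: "finite I" and cardI: "dim (UNIV :: 'a set) = card I" and ne: "I \<noteq> {}"
    and f: "span (f ` I) = alt_forms 1"
  obtains e where "\<And>i j. i \<in> I \<Longrightarrow> j \<in> I \<Longrightarrow> f i [e j] = (if i = j then 1 else 0)"
    and "\<And>x. (\<Sum>i\<in>I. f i [x] *\<^sub>R e i) = x"
proof -
  define \<Phi> where "\<Phi> x = (\<lambda>i. if i \<in> I then f i [x] else 0)" for x
  define \<delta> where "\<delta> j = (\<lambda>i::nat. if i = j then 1 else 0 :: real)" for j
  have fi: "f i \<in> alt_forms 1" if "i \<in> I" for i
    unfolding f[symmetric] by (rule span_base) (use that in simp)
  have lin: "linear \<Phi>"
    by (intro linearI)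
      (simp_all add: \<Phi>_def fun_eq_iff scaleR_fun_def linear_add[OF alt_forms_1_linear[OF fi]]
        linear_cmul[OF alt_forms_1_linear[OF fi]])
  obtain B :: "'a set" where B: "independent B" "UNIV \<subseteq> span B" "card B = dim (UNIV :: 'a set)"
    by (metis basis_exists)
  have vanish: "x = 0" if "\<Phi> x = 0" for x
  proof -
    have fx: "f i [x] = 0" if "i \<in> I" for i
      using that fun_cong[OF \<open>\<Phi> x = 0\<close>, of i] by (simp add: \<Phi>_def)
    have g0: "\<gamma> [x] = 0" if "\<gamma> \<in> alt_forms 1" for \<gamma>
    proof -
      have "\<gamma> \<in> span (f ` I)" using that f by simp
      then show ?thesis
        by (induction rule: span_induct_alt) (auto simp: fx scaleR_fun_def)
    qed
    have r0: "representation B x b = 0" for b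
    proof -
      have "linear (\<lambda>y. representation B y b)"
        using B by (intro linearI) (simp_all add: representation_add representation_scale top.extremum_unique)
      from g0[OF covector_in_alt_forms[OF this]] show ?thesis by (simp add: covector_def)
    qed
    have "(\<Sum>b | representation B x b \<noteq> 0. representation B x b *\<^sub>R b) = x"
      using B by (intro sum_nonzero_representation_eq) auto
    then show "x = 0" by (simp add: r0)
  qed
  have inj: "inj \<Phi>" using vanish linear_injective_0[OF lin] by blast
  have exp: "v = (\<Sum>i\<in>I. v i *\<^sub>R \<delta> i)" if "\<And>i. i \<notin> I \<Longrightarrow> v i = 0" for v
  proof
    fix j
    have "(\<Sum>i\<in>I. v i *\<^sub>R \<delta> i) j = (\<Sum>i\<in>I. if i = j then v i else 0)"
      by (induction rule: infinite_finite_induct) (auto simp: \<delta>_def scaleR_fun_def)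
    then show "v j = (\<Sum>i\<in>I. v i *\<^sub>R \<delta> i) j" using that[of j] fin by (cases "j \<in> I") simp_all
  qed
  have "\<Phi> x \<in> span (\<delta> ` I)" for x
  proof -
    have "(\<Sum>i\<in>I. \<Phi> x i *\<^sub>R \<delta> i) \<in> span (\<delta> ` I)"
      by (rule span_sum, rule span_scale, rule span_base) simp
    then show ?thesis using exp[of "\<Phi> x"] by (simp add: \<Phi>_def)
  qed
  then have sub: "\<Phi> ` B \<subseteq> span (\<delta> ` I)" by blast
  have ind: "independent (\<Phi> ` B)"
    by (rule linear_independent_injective_image[OF lin B(1)]) (rule inj_on_subset[OF inj subset_UNIV])
  have "card (\<delta> ` I) \<le> card (\<Phi> ` B)"
    using B(3) cardI card_image_le[OF fin, of \<delta>] card_image[OF inj_on_subset[OF inj subset_UNIV], of B]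
    by simp
  then have "span (\<delta> ` I) \<subseteq> span (\<Phi> ` B)"
    by (intro span_subset_of_card_le ind sub finite_imageI fin)
  also have "\<dots> \<subseteq> range \<Phi>" unfolding linear_span_image[OF lin] by blast
  finally have "\<delta> j \<in> range \<Phi>" if "j \<in> I" for j
    using that span_superset[of "\<delta> ` I"] by blast
  then have "\<forall>j. \<exists>y. j \<in> I \<longrightarrow> \<Phi> y = \<delta> j" by (metis imageE)
  then obtain e where e: "\<And>j. j \<in> I \<Longrightarrow> \<Phi> (e j) = \<delta> j" by metis
  show thesis
  proof
    show "f i [e j] = (if i = j then 1 else 0)" if "i \<in> I" "j \<in> I" for i j
      using fun_cong[OF e[OF that(2)], of i] that by (simp add: \<Phi>_def \<delta>_def)
    show "(\<Sum>i\<in>I. f i [x] *\<^sub>R e i) = x" for x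
    proof (rule injD[OF inj])
      have "\<Phi> (\<Sum>i\<in>I. f i [x] *\<^sub>R e i) = (\<Sum>i\<in>I. f i [x] *\<^sub>R \<Phi> (e i))"
        by (simp add: linear_sum[OF lin] linear_cmul[OF lin])
      also have "\<dots> = (\<Sum>i\<in>I. \<Phi> x i *\<^sub>R \<delta> i)"
        by (intro sum.cong refl) (simp add: e, simp add: \<Phi>_def)
      also have "\<dots> = \<Phi> x" by (rule exp[symmetric]) (simp add: \<Phi>_def)
      finally show "\<Phi> (\<Sum>i\<in>I. f i [x] *\<^sub>R e i) = \<Phi> x" .
    qed
  qed
qed

text \<open>
  Expanding the first argument of a multilinear form \<open>\<omega>\<close> gives
  \<open>\<omega> = \<Sum>\<^sub>i \<phi>\<^sub>i \<otimes> \<omega>(e\<^sub>i, \<dots>)\<close>, so generators in degree \<open>k\<close>, tensored with the \<open>\<phi>\<^sub>i\<close>, generate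
  degree \<open>k + 1\<close>. Multilinear forms are used instead of alternating ones because the tensor
  product with a covector does not preserve the alternating property.
\<close>

lemma multilinear_finitely_generated:
  fixes \<phi> :: "'i \<Rightarrow> 'a::real_vector \<Rightarrow> real"
  assumes fin: "finite I" and res: "\<And>x. (\<Sum>i\<in>I. \<phi> i x *\<^sub>R e i) = x"
  shows "\<exists>T. finite T \<and> {\<omega> :: 'a form. (\<forall>xs. length xs \<noteq> k \<longrightarrow> \<omega> xs = 0) \<and>
     (\<forall>xs i. length xs = k \<longrightarrow> i < k \<longrightarrow> linear (\<lambda>x. \<omega> (xs[i := x])))} \<subseteq> span T"
proof (induction k)
  case 0
  have "\<omega> = \<omega> [] *\<^sub>R (\<lambda>xs. if xs = [] then 1 else 0)"
    if "\<forall>xs. length xs \<noteq> 0 \<longrightarrow> \<omega> xs = 0" for \<omega> :: "'a form"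
    using that by (auto simp: fun_eq_iff scaleR_fun_def)
  then show ?case
    by (intro exI[of _ "{\<lambda>xs. if xs = [] then 1 else 0}"]) (auto simp: span_singleton)
next
  case (Suc k)
  then obtain T where T: "finite T" and sub: "{\<omega> :: 'a form. (\<forall>xs. length xs \<noteq> k \<longrightarrow> \<omega> xs = 0) \<and>
     (\<forall>xs i. length xs = k \<longrightarrow> i < k \<longrightarrow> linear (\<lambda>x. \<omega> (xs[i := x])))} \<subseteq> span T" by blast
  define tensor :: "('a \<Rightarrow> real) \<Rightarrow> 'a form \<Rightarrow> 'a form"
    where "tensor p \<eta> = (\<lambda>xs. case xs of [] \<Rightarrow> 0 | x # ys \<Rightarrow> p x * \<eta> ys)" for p \<eta>
  have tlin: "linear (tensor p)" for p
    by (intro linearI) (auto simp: tensor_def fun_eq_iff scaleR_fun_def algebra_simps split: list.splits)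
  define T' where "T' = (\<Union>i\<in>I. tensor (\<phi> i) ` T)"
  have "\<omega> \<in> span T'"
    if van: "\<And>xs. length xs \<noteq> Suc k \<Longrightarrow> \<omega> xs = 0"
      and lin: "\<And>xs i. length xs = Suc k \<Longrightarrow> i < Suc k \<Longrightarrow> linear (\<lambda>x. \<omega> (xs[i := x]))"
    for \<omega> :: "'a form"
  proof -
    have part: "tensor (\<phi> i) (\<lambda>ys. \<omega> (e i # ys)) \<in> span T'" if "i \<in> I" for i
    proof -
      have "(\<lambda>ys. \<omega> (e i # ys)) \<in> span T"
        using lin[of "e i # _" "Suc _"] by (intro subsetD[OF sub]) (auto simp: van)
      then have "tensor (\<phi> i) (\<lambda>ys. \<omega> (e i # ys)) \<in> span (tensor (\<phi> i) ` T)"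
        by (simp add: linear_span_image[OF tlin])
      also have "\<dots> \<subseteq> span T'" by (rule span_mono) (use that in \<open>auto simp: T'_def\<close>)
      finally show ?thesis .
    qed
    have "\<omega> = (\<Sum>i\<in>I. tensor (\<phi> i) (\<lambda>ys. \<omega> (e i # ys)))"
    proof
      fix xs
      have s: "(\<Sum>i\<in>I. tensor (\<phi> i) (\<lambda>ys. \<omega> (e i # ys))) xs
          = (\<Sum>i\<in>I. tensor (\<phi> i) (\<lambda>ys. \<omega> (e i # ys)) xs)"
        by (induction I rule: infinite_finite_induct) auto
      show "\<omega> xs = (\<Sum>i\<in>I. tensor (\<phi> i) (\<lambda>ys. \<omega> (e i # ys))) xs"
      proof (cases "length xs = Suc k")
        case True
        then obtain x ys where xs: "xs = x # ys" "length ys = k" by (auto simp: length_Suc_conv)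
        have l: "linear (\<lambda>z. \<omega> (z # ys))" using lin[of "x # ys" 0] xs by simp
        have "\<omega> xs = \<omega> ((\<Sum>i\<in>I. \<phi> i x *\<^sub>R e i) # ys)" by (simp add: res xs)
        also have "\<dots> = (\<Sum>i\<in>I. \<phi> i x * \<omega> (e i # ys))"
          by (simp add: linear_sum[OF l] linear_cmul[OF l])
        finally show ?thesis unfolding s by (simp add: tensor_def xs)
      next
        case False
        then have "tensor (\<phi> i) (\<lambda>ys. \<omega> (e i # ys)) xs = 0" for i
          by (auto simp: tensor_def van split: list.splits)
        then show ?thesis using False unfolding s by (simp add: van)
      qed
    qed
    also have "\<dots> \<in> span T'" by (intro span_sum part)
    finally show ?thesis .
  qed
  moreover have "finite T'" using fin T by (simp add: T'_def)
  ultimately show ?case by (intro exI[of _ T']) blast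
qed

section \<open>Wedge products and differentials in low degree\<close>

lemma nths_omit_one:
  assumes "i < length xs"
  shows "nths xs ({..<length xs} - {i}) = take i xs @ drop (Suc i) xs"
proof -
  have "nths xs ({..<length xs} - {i})
      = nths (take i xs @ xs ! i # drop (Suc i) xs) ({..<length xs} - {i})"
    using id_take_nth_drop[OF assms] by simp
  also have "\<dots> = take i xs @ drop (Suc i) xs"
    using assms by (auto simp: nths_append nths_Cons intro!: arg_cong2[of _ _ _ _ "(@)"] nths_all)
  finally show ?thesis .
qed

lemma length_nths_subset: "I \<subseteq> {..<length xs} \<Longrightarrow> length (nths xs I) = card I"
  unfolding length_nths by (rule arg_cong[of _ _ card]) auto

lemma nths_single: "i < length xs \<Longrightarrow> nths xs {i} = [xs ! i]"
    by (induction xs arbitrary: i) (auto simp: nths_Cons nth_Cons split: nat.splits)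

lemma wedge_degree:
  assumes "\<omega> \<in> alt_forms p" "\<eta> \<in> alt_forms q" "length xs \<noteq> p + q"
  shows "(\<omega> \<and>\<^sub>f \<eta>) xs = 0"
proof -
  have "\<omega> (nths xs I) * \<eta> (nths xs ({..<length xs} - I)) = 0" if "I \<subseteq> {..<length xs}" for I
  proof -
    have "card I + card ({..<length xs} - I) = length xs"
      using that by (simp add: card_Diff_subset finite_subset[OF that] card_mono[of "{..<length xs}" I, simplified])
    then have "length (nths xs I) \<noteq> p \<or> length (nths xs ({..<length xs} - I)) \<noteq> q"
      using assms(3) that by (auto simp: length_nths_subset)
    then show ?thesis using assms(1,2) by (auto dest: alt_forms_vanish)
  qed
  then show ?thesis unfolding wedge_def by (intro sum.neutral) (simp add: mult.assoc)
qed

text \<open>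
  When one factor is a covector, only the shuffles that single out one position contribute. This turns
  the sum over all subsets of positions into a sum over positions, which can be written out for
  arguments of a given length.
\<close>

lemma covector_wedge:
  assumes \<gamma>: "\<gamma> \<in> alt_forms 1"
  shows "(\<gamma> \<and>\<^sub>f \<eta>) xs = (\<Sum>i<length xs. (-1) ^ i * \<gamma> [xs ! i] * \<eta> (take i xs @ drop (Suc i) xs))"
proof -
  let ?n = "length xs"
  let ?t = "\<lambda>I. (-1) ^ card {(i, j). i \<in> I \<and> j \<in> {..<?n} - I \<and> j < i}
        * \<gamma> (nths xs I) * \<eta> (nths xs ({..<?n} - I))"
  have "(\<gamma> \<and>\<^sub>f \<eta>) xs = sum ?t ((\<lambda>i. {i}) ` {..<?n})"
    unfolding wedge_def
  proof (rule sum.mono_neutral_right)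
    show "\<forall>I\<in>Pow {..<?n} - (\<lambda>i. {i}) ` {..<?n}. ?t I = 0"
    proof
      fix I assume I: "I \<in> Pow {..<?n} - (\<lambda>i. {i}) ` {..<?n}"
      then have "card I \<noteq> 1" by (auto simp: card_1_singleton_iff)
      then have "\<gamma> (nths xs I) = 0" using I by (intro alt_forms_vanish[OF \<gamma>]) (auto simp: length_nths_subset)
      then show "?t I = 0" by simp
    qed
  qed auto
  also have "\<dots> = (\<Sum>i<?n. ?t {i})" by (simp add: sum.reindex)
  also have "\<dots> = (\<Sum>i<?n. (-1) ^ i * \<gamma> [xs ! i] * \<eta> (take i xs @ drop (Suc i) xs))"
  proof (rule sum.cong[OF refl])
    fix i assume i: "i \<in> {..<?n}"
    have "{(i', j). i' \<in> {i} \<and> j \<in> {..<?n} - {i} \<and> j < i'} = Pair i ` {..<i}" using i by auto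
    then have "card {(i', j). i' \<in> {i} \<and> j \<in> {..<?n} - {i} \<and> j < i'} = i"
      by (simp add: card_image inj_on_def)
    then show "?t {i} = (-1) ^ i * \<gamma> [xs ! i] * \<eta> (take i xs @ drop (Suc i) xs)"
      using i by (simp add: nths_omit_one nths_single)
  qed
  finally show ?thesis .
qed

lemma wedge_covector:
  assumes \<gamma>: "\<gamma> \<in> alt_forms 1"
  shows "(\<omega> \<and>\<^sub>f \<gamma>) xs
    = (\<Sum>i<length xs. (-1) ^ (length xs - Suc i) * \<omega> (take i xs @ drop (Suc i) xs) * \<gamma> [xs ! i])"
proof -
  let ?n = "length xs"
  let ?t = "\<lambda>I. (-1) ^ card {(i, j). i \<in> I \<and> j \<in> {..<?n} - I \<and> j < i}
        * \<omega> (nths xs I) * \<gamma> (nths xs ({..<?n} - I))"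
  have "(\<omega> \<and>\<^sub>f \<gamma>) xs = sum ?t ((\<lambda>i. {..<?n} - {i}) ` {..<?n})"
    unfolding wedge_def
  proof (rule sum.mono_neutral_right)
    show "\<forall>I\<in>Pow {..<?n} - (\<lambda>i. {..<?n} - {i}) ` {..<?n}. ?t I = 0"
    proof
      fix I assume I: "I \<in> Pow {..<?n} - (\<lambda>i. {..<?n} - {i}) ` {..<?n}"
      have "card ({..<?n} - I) \<noteq> 1"
      proof
        assume "card ({..<?n} - I) = 1"
        then obtain i where i: "{..<?n} - I = {i}" by (auto simp: card_1_singleton_iff)
        then have "I = {..<?n} - {i}" "i \<in> {..<?n}" using I by auto
        then show False using I by blast
      qed
      then have "\<gamma> (nths xs ({..<?n} - I)) = 0"
        using I by (intro alt_forms_vanish[OF \<gamma>]) (auto simp: length_nths_subset)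
      then show "?t I = 0" by simp
    qed
  qed auto
  also have "\<dots> = (\<Sum>i<?n. ?t ({..<?n} - {i}))"
    by (subst sum.reindex) (auto simp: inj_on_def)
  also have "\<dots> = (\<Sum>i<?n. (-1) ^ (?n - Suc i) * \<omega> (take i xs @ drop (Suc i) xs) * \<gamma> [xs ! i])"
  proof (rule sum.cong[OF refl])
    fix i assume i: "i \<in> {..<?n}"
    have c: "{..<?n} - ({..<?n} - {i}) = {i}" using i by auto
    have "{(i', j). i' \<in> {..<?n} - {i} \<and> j \<in> {i} \<and> j < i'} = (\<lambda>k. (k, i)) ` {Suc i..<?n}" using i by auto
    then have "card {(i', j). i' \<in> {..<?n} - {i} \<and> j \<in> {i} \<and> j < i'} = ?n - Suc i"
      by (simp add: card_image inj_on_def)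
    then show "?t ({..<?n} - {i}) = (-1) ^ (?n - Suc i) * \<omega> (take i xs @ drop (Suc i) xs) * \<gamma> [xs ! i]"
      using i by (simp add: nths_omit_one nths_single c)
  qed
  finally show ?thesis .
qed

lemma linear_L_op: "linear (L_op \<gamma>)"
  by (intro linearI)
    (simp_all add: fun_eq_iff wedge_def scaleR_fun_def sum.distrib sum_distrib_left algebra_simps)

lemma covector_wedge_2:
  assumes "\<gamma> \<in> alt_forms 1"
  shows "(\<gamma> \<and>\<^sub>f \<eta>) [x, y] = \<gamma> [x] * \<eta> [y] - \<gamma> [y] * \<eta> [x]"
  by (simp add: covector_wedge[OF assms] eval_nat_numeral)

lemma covector_wedge_3:
  assumes "\<gamma> \<in> alt_forms 1"
  shows "(\<gamma> \<and>\<^sub>f \<eta>) [x, y, z] = \<gamma> [x] * \<eta> [y, z] - \<gamma> [y] * \<eta> [x, z] + \<gamma> [z] * \<eta> [x, y]"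
  by (simp add: covector_wedge[OF assms] eval_nat_numeral)

lemma covector_wedge_4:
  assumes "\<gamma> \<in> alt_forms 1"
  shows "(\<gamma> \<and>\<^sub>f \<eta>) [x, y, z, w]
    = \<gamma> [x] * \<eta> [y, z, w] - \<gamma> [y] * \<eta> [x, z, w] + \<gamma> [z] * \<eta> [x, y, w] - \<gamma> [w] * \<eta> [x, y, z]"
  by (simp add: covector_wedge[OF assms] eval_nat_numeral)

lemma covector_wedge_5:
  assumes "\<gamma> \<in> alt_forms 1"
  shows "(\<gamma> \<and>\<^sub>f \<eta>) [x, y, z, w, v]
    = \<gamma> [x] * \<eta> [y, z, w, v] - \<gamma> [y] * \<eta> [x, z, w, v] + \<gamma> [z] * \<eta> [x, y, w, v]
      - \<gamma> [w] * \<eta> [x, y, z, v] + \<gamma> [v] * \<eta> [x, y, z, w]"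
  by (simp add: covector_wedge[OF assms] eval_nat_numeral)

lemma wedge_covector_3:
  assumes "\<gamma> \<in> alt_forms 1"
  shows "(\<omega> \<and>\<^sub>f \<gamma>) [x, y, z] = \<omega> [x, y] * \<gamma> [z] - \<omega> [x, z] * \<gamma> [y] + \<omega> [y, z] * \<gamma> [x]"
  by (simp add: wedge_covector[OF assms] eval_nat_numeral)

lemma two_form_linear:
  assumes "\<omega> \<in> alt_forms 2"
  shows "linear (\<lambda>x. \<omega> [x, y])" and "linear (\<lambda>y. \<omega> [x, y])" and "\<omega> [x, x] = 0"
proof -
  have l: "linear (\<lambda>t. \<omega> (xs[i := t]))" if "length xs = 2" "i < 2" for xs i
    using assms that unfolding alt_forms_def by blast
  show "linear (\<lambda>x. \<omega> [x, y])" using l[of "[y, y]" 0] by simp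
  show "linear (\<lambda>y. \<omega> [x, y])" using l[of "[x, x]" 1] by simp
  have "\<forall>xs i j. length xs = 2 \<longrightarrow> i < j \<longrightarrow> j < 2 \<longrightarrow> xs ! i = xs ! j \<longrightarrow> \<omega> xs = 0"
    using assms unfolding alt_forms_def by blast
  from this[rule_format, of "[x, x]" 0 1] show "\<omega> [x, x] = 0" by simp
qed

lemma two_form_wedge_covector_in_alt_forms:
  assumes \<omega>: "\<omega> \<in> alt_forms 2" and \<gamma>: "\<gamma> \<in> alt_forms 1"
  shows "\<omega> \<and>\<^sub>f \<gamma> \<in> alt_forms 3"
proof -
  note lins = two_form_linear[OF \<omega>] alt_forms_1_linear[OF \<gamma>]
  have l3: "\<exists>x y z. xs = [x, y, z]" if "length xs = 3" for xs :: "'a list"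
    using that by (auto simp: eval_nat_numeral length_Suc_conv)
  have "linear (\<lambda>t. (\<omega> \<and>\<^sub>f \<gamma>) (xs[i := t]))" if len: "length xs = 3" and i: "i < 3" for xs i
  proof -
    obtain x y z where xs: "xs = [x, y, z]" using l3[OF len] by metis
    consider "i = 0" | "i = 1" | "i = 2" using i by linarith
    then show ?thesis
      by cases (auto simp: xs wedge_covector_3[OF \<gamma>] algebra_simps linear_add[OF lins(1)] linear_cmul[OF lins(1)]
        linear_add[OF lins(2)] linear_cmul[OF lins(2)] linear_add[OF lins(4)] linear_cmul[OF lins(4)] eval_nat_numeral
        intro!: linearI)
  qed
  moreover have "(\<omega> \<and>\<^sub>f \<gamma>) xs = 0" if len: "length xs = 3" and ij: "i < j" "j < 3" and eq: "xs ! i = xs ! j" for xs i j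
  proof -
    obtain x y z where xs: "xs = [x, y, z]" using l3[OF len] by metis
    consider "i = 0 \<and> j = 1" | "i = 0 \<and> j = 2" | "i = 1 \<and> j = 2" using ij by linarith
    moreover have "\<omega> [y, x] = - \<omega> [x, y]"
      using lins(3)[of "x + y"] lins(3)[of x] lins(3)[of y]
      by (simp add: linear_add[OF lins(1)] linear_add[OF lins(2)])
    ultimately show ?thesis using eq
      by cases (auto simp: xs wedge_covector_3[OF \<gamma>] lins(3) eval_nat_numeral)
  qed
  ultimately show ?thesis using wedge_degree[OF \<omega> \<gamma>] unfolding alt_forms_def by auto
qed

text \<open>
  The next two lemmas replace associativity and graded commutativity of the wedge product:
  together they give \<open>\<alpha> \<and> (\<beta> \<and> (\<omega> \<and> \<alpha>)) = - \<beta> \<and> (\<alpha> \<and> (\<omega> \<and> \<alpha>)) = 0\<close>.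
\<close>

lemma covector_wedge_swap:
  assumes \<alpha>: "\<alpha> \<in> alt_forms 1" and \<beta>: "\<beta> \<in> alt_forms 1" and \<eta>: "\<eta> \<in> alt_forms 3"
  shows "\<alpha> \<and>\<^sub>f (\<beta> \<and>\<^sub>f \<eta>) = - (\<beta> \<and>\<^sub>f (\<alpha> \<and>\<^sub>f \<eta>))"
proof
  fix xs :: "'a list"
  show "(\<alpha> \<and>\<^sub>f (\<beta> \<and>\<^sub>f \<eta>)) xs = (- (\<beta> \<and>\<^sub>f (\<alpha> \<and>\<^sub>f \<eta>))) xs"
  proof (cases "length xs = 5")
    case True
    then obtain a b c d e where xs: "xs = [a, b, c, d, e]"
      by (auto simp: eval_nat_numeral length_Suc_conv)
    show ?thesis
      by (simp add: xs covector_wedge_5[OF \<alpha>] covector_wedge_5[OF \<beta>]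
        covector_wedge_4[OF \<alpha>] covector_wedge_4[OF \<beta>] algebra_simps)
  next
    case False
    then show ?thesis
      by (simp add: covector_wedge[OF \<alpha>] covector_wedge[OF \<beta>] alt_forms_vanish[OF \<eta>])
  qed
qed

lemma covector_wedge_square:
  assumes \<alpha>: "\<alpha> \<in> alt_forms 1" and \<omega>: "\<omega> \<in> alt_forms 2"
  shows "\<alpha> \<and>\<^sub>f (\<omega> \<and>\<^sub>f \<alpha>) = 0"
proof
  fix xs :: "'a list"
  show "(\<alpha> \<and>\<^sub>f (\<omega> \<and>\<^sub>f \<alpha>)) xs = 0 xs"
  proof (cases "length xs = 4")
    case True
    then obtain a b c d where xs: "xs = [a, b, c, d]"
      by (auto simp: eval_nat_numeral length_Suc_conv)
    show ?thesis
      by (simp add: xs covector_wedge_4[OF \<alpha>] wedge_covector_3[OF \<alpha>] algebra_simps)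
  next
    case False
    then show ?thesis by (simp add: covector_wedge[OF \<alpha>] wedge_degree[OF \<omega> \<alpha>])
  qed
qed

lemma ce_d_two_form:
  "ce_d br \<omega> [x, y, z] = - \<omega> [br x y, z] + \<omega> [br x z, y] - \<omega> [br y z, x]"
proof -
  have "{(i, j). i < j \<and> j < length [x, y, z]} = {(0, 1), (0, 2), (1, 2)}"
    by (auto simp: less_Suc_eq eval_nat_numeral)
  then show ?thesis by (simp add: ce_d_def nths_Cons)
qed

section \<open>Forms adapted to an SU(2)-structure\<close>

lemma sum_1_to_5: "(\<Sum>i\<in>{1..5::nat}. g i) = g 1 + g 2 + g 3 + g 4 + g 5"
  for g :: "nat \<Rightarrow> 'v::comm_monoid_add"
  by (simp add: eval_nat_numeral)

locale adapted_coframe =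
  fixes f :: "nat \<Rightarrow> 'a::real_vector form" and e :: "nat \<Rightarrow> 'a"
  assumes cov: "i \<in> {1..5} \<Longrightarrow> f i \<in> alt_forms 1"
    and dual: "i \<in> {1..5} \<Longrightarrow> j \<in> {1..5} \<Longrightarrow> f i [e j] = (if i = j then 1 else 0)"
    and resolution: "(\<Sum>i\<in>{1..5}. f i [x] *\<^sub>R e i) = x"
begin

abbreviation "\<alpha> \<equiv> f 5"
abbreviation "\<omega>\<^sub>1 \<equiv> f 1 \<and>\<^sub>f f 2 + f 3 \<and>\<^sub>f f 4"
abbreviation "\<omega>\<^sub>2 \<equiv> f 1 \<and>\<^sub>f f 3 + f 4 \<and>\<^sub>f f 2"
abbreviation "\<omega>\<^sub>3 \<equiv> f 1 \<and>\<^sub>f f 4 + f 2 \<and>\<^sub>f f 3"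

lemma trace_eq: "linear A \<Longrightarrow> endo_trace A = (\<Sum>i\<in>{1..5}. f i [A (e i)])"
  by (rule endo_trace_dual_basis[where \<phi> = "\<lambda>i x. f i [x]"])
    (simp_all add: alt_forms_1_linear[OF cov] resolution del: One_nat_def)

lemma alt_forms_finitely_generated: "\<exists>T. finite T \<and> alt_forms k \<subseteq> (span T :: 'a form set)"
proof -
  obtain T where "finite T" "{\<omega> :: 'a form. (\<forall>xs. length xs \<noteq> k \<longrightarrow> \<omega> xs = 0) \<and>
     (\<forall>xs i. length xs = k \<longrightarrow> i < k \<longrightarrow> linear (\<lambda>x. \<omega> (xs[i := x])))} \<subseteq> span T"
    using multilinear_finitely_generated[where I = "{1..5}" and \<phi> = "\<lambda>i x. f i [x]" and k = k, OF _ resolution]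
    by blast
  then show ?thesis unfolding alt_forms_def by blast
qed

lemma covector_expand:
  assumes \<beta>: "\<beta> \<in> alt_forms 1"
  shows "\<beta> [x] = (\<Sum>i\<in>{1..5}. f i [x] * \<beta> [e i])"
proof -
  note l = alt_forms_1_linear[OF \<beta>]
  have "\<beta> [x] = \<beta> [\<Sum>i\<in>{1..5}. f i [x] *\<^sub>R e i]" by (simp only: resolution)
  then show ?thesis by (simp add: linear_sum[OF l] linear_cmul[OF l])
qed

text \<open>
  For \<open>v = [e\<^sub>5, e\<^sub>1]\<close> one has \<open>\<omega>\<^sub>1(v, e\<^sub>2) = f\<^sup>1(v)\<close>, and similarly for the other brackets, while
  \<open>\<omega>\<^sub>1(\<cdot>, e\<^sub>5) = 0\<close>. Hence the two evaluations of \<open>d\<omega>\<^sub>1\<close> below are, up to sign, the two halves of the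
  trace of \<open>ad e\<^sub>5\<close>.
\<close>

lemma trace_ad_eq_0:
  assumes lin: "linear (br (e 5))" and alt: "br (e 5) (e 5) = 0" and closed: "ce_d br \<omega>\<^sub>1 = 0"
  shows "endo_trace (br (e 5)) = 0"
proof -
  have "ce_d br \<omega>\<^sub>1 [e 5, e 1, e 2] = 0" "ce_d br \<omega>\<^sub>1 [e 5, e 3, e 4] = 0"
    using closed by simp_all
  then have "f 1 [br (e 5) (e 1)] + f 2 [br (e 5) (e 2)] = 0"
    "f 3 [br (e 5) (e 3)] + f 4 [br (e 5) (e 4)] = 0"
    by (simp_all add: ce_d_two_form covector_wedge_2[OF cov] dual)
  moreover have "f 5 [0] = 0" using linear_0[OF alt_forms_1_linear[OF cov[of 5]]] by simp
  ultimately show ?thesis using alt by (simp add: trace_eq[OF lin, unfolded sum_1_to_5])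
qed

text \<open>
  The product with \<open>\<omega>\<^sub>1\<close> appears as \<open>\<alpha> \<and> (\<beta> \<and> \<omega>\<^sub>1)\<close>, the form in which it arises from
  \<open>L\<^sub>\<alpha>(L\<^sub>\<beta>(Z\<^sup>2))\<close>; this changes the sign of its coefficients. Pairing the combination with each of
  the three orthogonal coefficient vectors isolates one of \<open>p, q, r\<close>, multiplied by the squared length
  of \<open>\<beta>\<close>.
\<close>

lemma wedge_combination_trivial:
  assumes \<beta>: "\<beta> \<in> alt_forms 1" and \<beta>5: "\<beta> [e 5] = 0" and nz: "\<beta> [x] \<noteq> 0"
    and comb: "p *\<^sub>R (\<alpha> \<and>\<^sub>f (\<beta> \<and>\<^sub>f \<omega>\<^sub>1)) + q *\<^sub>R (\<beta> \<and>\<^sub>f (\<omega>\<^sub>2 \<and>\<^sub>f \<alpha>)) + r *\<^sub>R (\<beta> \<and>\<^sub>f (\<omega>\<^sub>3 \<and>\<^sub>f \<alpha>)) = 0"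
  shows "p = 0 \<and> q = 0 \<and> r = 0"
proof -
  define b where "b i = \<beta> [e i]" for i
  note ev = covector_wedge_4[OF \<beta>] covector_wedge_3[OF \<beta>] covector_wedge_4[OF cov] covector_wedge_2[OF cov]
    wedge_covector_3[OF cov] dual \<beta>5 b_def scaleR_fun_def
  have "\<And>xs. (p *\<^sub>R (\<alpha> \<and>\<^sub>f (\<beta> \<and>\<^sub>f \<omega>\<^sub>1)) + q *\<^sub>R (\<beta> \<and>\<^sub>f (\<omega>\<^sub>2 \<and>\<^sub>f \<alpha>)) + r *\<^sub>R (\<beta> \<and>\<^sub>f (\<omega>\<^sub>3 \<and>\<^sub>f \<alpha>))) xs = 0"
    using comb by simp
  from this[of "[e 1, e 2, e 3, e 5]"] this[of "[e 1, e 2, e 4, e 5]"]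
    this[of "[e 1, e 3, e 4, e 5]"] this[of "[e 2, e 3, e 4, e 5]"]
  have eqs: "- p * b 3 - q * b 2 + r * b 1 = 0" "- p * b 4 - q * b 1 - r * b 2 = 0"
    "- p * b 1 + q * b 4 - r * b 3 = 0" "- p * b 2 + q * b 3 + r * b 4 = 0"
    by (simp_all add: ev)
  let ?N = "b 1 ^ 2 + b 2 ^ 2 + b 3 ^ 2 + b 4 ^ 2"
  have "p * ?N = 0" "q * ?N = 0" "r * ?N = 0" using eqs by algebra+
  moreover have "?N \<noteq> 0"
  proof
    assume "?N = 0"
    then have "b 1 = 0" "b 2 = 0" "b 3 = 0" "b 4 = 0" by (smt (verit) power2_less_eq_zero_iff zero_le_power2)+
    then have "\<beta> [x] = 0" using \<beta>5 by (simp add: covector_expand[OF \<beta>, of x, unfolded sum_1_to_5] b_def)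
    then show False using nz by simp
  qed
  ultimately show ?thesis by simp
qed

end

section \<open>The obstruction\<close>

theorem proposition9:
  fixes br :: "'a::real_vector \<Rightarrow> 'a \<Rightarrow> 'a" and \<beta> :: "'a form"
  assumes lie: "lie_algebra br"
    and dim5: "dim (UNIV :: 'a set) = 5"
    and nonunimodular: "\<not> unimodular br"
    and beta: "\<beta> = covector (\<lambda>X. endo_trace (br X))"
    and cond: "dim (L_op \<beta> ` closed_forms br 3) < 2 \<or>
      (dim (L_op \<beta> ` closed_forms br 3) = 2 \<and>
       (\<forall>\<alpha> \<in> alt_forms 1. L_op \<alpha> ` L_op \<beta> ` closed_forms br 3 = {0} \<longrightarrow>
          L_op \<alpha> ` L_op \<beta> ` closed_forms br 2 \<subseteq> L_op \<beta> ` closed_forms br 3))"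
  shows "\<not> (\<exists>\<alpha> \<omega>\<^sub>1 \<omega>\<^sub>2 \<omega>\<^sub>3. hypo_structure br \<alpha> \<omega>\<^sub>1 \<omega>\<^sub>2 \<omega>\<^sub>3)"
proof
  assume "\<exists>\<alpha> \<omega>\<^sub>1 \<omega>\<^sub>2 \<omega>\<^sub>3. hypo_structure br \<alpha> \<omega>\<^sub>1 \<omega>\<^sub>2 \<omega>\<^sub>3"
  then obtain f :: "nat \<Rightarrow> 'a form" where span_f: "span (f ` {1..5}) = alt_forms 1"
    and alt2: "f 1 \<and>\<^sub>f f 2 + f 3 \<and>\<^sub>f f 4 \<in> alt_forms 2" "f 1 \<and>\<^sub>f f 3 + f 4 \<and>\<^sub>f f 2 \<in> alt_forms 2"
      "f 1 \<and>\<^sub>f f 4 + f 2 \<and>\<^sub>f f 3 \<in> alt_forms 2"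
    and closed: "ce_d br (f 1 \<and>\<^sub>f f 2 + f 3 \<and>\<^sub>f f 4) = 0"
      "ce_d br ((f 1 \<and>\<^sub>f f 3 + f 4 \<and>\<^sub>f f 2) \<and>\<^sub>f f 5) = 0"
      "ce_d br ((f 1 \<and>\<^sub>f f 4 + f 2 \<and>\<^sub>f f 3) \<and>\<^sub>f f 5) = 0"
    unfolding hypo_structure_def by blast
  obtain e where dual: "\<And>i j. i \<in> {1..5} \<Longrightarrow> j \<in> {1..5} \<Longrightarrow> f i [e j] = (if i = j then 1 else 0)"
    and res: "\<And>x. (\<Sum>i\<in>{1..5}. f i [x] *\<^sub>R e i) = x"
    by (rule coframe_dual_basis[of "{1..5}" f]) (use dim5 span_f in auto)
  have cov: "f i \<in> alt_forms 1" if "i \<in> {1..5}" for i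
    unfolding span_f[symmetric] by (rule span_base) (use that in blast)
  interpret adapted_coframe f e
    by unfold_locales (fact cov dual res)+
  have br: "linear (br x)" "linear (\<lambda>x. br x y)" "br x x = 0" for x y
    using lie unfolding lie_algebra_def by blast+

  have "linear (\<lambda>X. endo_trace (br X))"
    by (intro linearI)
      (simp_all add: trace_eq[OF br(1)] linear_add[OF br(2)] linear_cmul[OF br(2)] sum_distrib_left
        linear_add[OF alt_forms_1_linear[OF cov]] linear_cmul[OF alt_forms_1_linear[OF cov]]
        sum.distrib del: One_nat_def)
  then have \<beta>: "\<beta> \<in> alt_forms 1" unfolding beta by (rule covector_in_alt_forms)
  have \<beta>_eq: "\<beta> [X] = endo_trace (br X)" for X by (simp add: beta covector_def)
  have \<beta>5: "\<beta> [e 5] = 0" unfolding \<beta>_eq by (rule trace_ad_eq_0[where br = br, OF br(1) br(3) closed(1)])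
  obtain X where X: "\<beta> [X] \<noteq> 0" using nonunimodular unfolding unimodular_def \<beta>_eq by blast

  define V where "V = L_op \<beta> ` closed_forms br 3"
  define u where "u = \<beta> \<and>\<^sub>f (\<omega>\<^sub>2 \<and>\<^sub>f \<alpha>)"
  define v where "v = \<beta> \<and>\<^sub>f (\<omega>\<^sub>3 \<and>\<^sub>f \<alpha>)"
  define w where "w = \<alpha> \<and>\<^sub>f (\<beta> \<and>\<^sub>f \<omega>\<^sub>1)"
  have \<alpha>: "\<alpha> \<in> alt_forms 1" by (rule cov) simp
  have indep: "p = 0 \<and> q = 0 \<and> r = 0" if "p *\<^sub>R w + q *\<^sub>R u + r *\<^sub>R v = 0" for p q r
    using wedge_combination_trivial[OF \<beta> \<beta>5 X] that unfolding u_def v_def w_def by blast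
  have pair: "u \<noteq> v" "independent {u, v}"
    using independent_pairI[of u v] indep[of 0] by auto
  have uV: "u \<in> V" and vV: "v \<in> V"
    unfolding u_def v_def V_def closed_forms_def
    using two_form_wedge_covector_in_alt_forms[OF _ \<alpha>] alt2 closed by blast+
  obtain T :: "'a form set" where T: "finite T" "alt_forms 3 \<subseteq> span T"
    using alt_forms_finitely_generated by blast
  have "V \<subseteq> L_op \<beta> ` span T" using T(2) unfolding V_def closed_forms_def by blast
  then have VT: "V \<subseteq> span (L_op \<beta> ` T)" by (simp only: linear_span_image[OF linear_L_op])
  note two_dim = independent_pair_dim[OF finite_imageI[OF T(1)] VT uV vV pair]
  have dimV: "dim V = 2" and cond2: "L_op \<alpha> ` V = {0} \<Longrightarrow> L_op \<alpha> ` L_op \<beta> ` closed_forms br 2 \<subseteq> V"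
    using cond two_dim(1) \<alpha> unfolding V_def by auto
  have V_comb: "\<exists>q r. z = q *\<^sub>R u + r *\<^sub>R v" if "z \<in> V" for z
  proof -
    have "z \<in> span {u, v}" using two_dim(2)[OF dimV] that by blast
    then obtain q where "z - q *\<^sub>R u \<in> span {v}" by (auto simp: span_breakdown_eq)
    then obtain r where "z - q *\<^sub>R u = r *\<^sub>R v" by (auto simp: span_singleton)
    then show ?thesis by (metis add.commute diff_eq_eq)
  qed
  \<comment> \<open>The hypothesis in (ii) holds for the covector \<open>\<alpha>\<close> of the hypo structure.\<close>
  have kill: "\<alpha> \<and>\<^sub>f (\<beta> \<and>\<^sub>f (\<omega> \<and>\<^sub>f \<alpha>)) = 0" if "\<omega> \<in> alt_forms 2" for \<omega>
    using covector_wedge_swap[OF \<alpha> \<beta> two_form_wedge_covector_in_alt_forms[OF that \<alpha>]]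
      covector_wedge_square[OF \<alpha> that] linear_0[OF linear_L_op[of \<beta>]] by simp
  have "L_op \<alpha> z = 0" if z: "z \<in> V" for z
  proof -
    obtain q r where "z = q *\<^sub>R u + r *\<^sub>R v" using V_comb[OF z] by blast
    then show ?thesis using kill[OF alt2(2)] kill[OF alt2(3)]
      by (simp add: linear_add[OF linear_L_op] linear_cmul[OF linear_L_op] u_def v_def)
  qed
  then have "L_op \<alpha> ` V = {0}" using uV by auto
  from cond2[OF this] have "w \<in> V"
    unfolding w_def closed_forms_def using alt2(1) closed(1) by blast
  then obtain q r where "w = q *\<^sub>R u + r *\<^sub>R v" using V_comb by blast
  then have "1 *\<^sub>R w + (- q) *\<^sub>R u + (- r) *\<^sub>R v = 0" by simp
  from indep[OF this] show False by simp
qed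

end
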